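(* $$\liminf_{n\to\infty} r(S_n) = \liminf_{n\to\infty} r(N_n) = 0 \quad\text{and}\quad \limsup_{n\to\infty} r(S_n) = \limsup_{n\to\infty} r(N_n) = 1.$$
   Context: For a positive integer $n$, $\mathbb{Z}_n$ denotes the ring of integers modulo $n$. Define $S_n := \{ m \in \mathbb{Z}_n : m = x^2 + y^2 \text{ for some } x, y \in \mathbb{Z}_n\}$ (zero is allowed as one or both squares) and $N_n := \mathbb{Z}_n \setminus S_n$. For a subset $A \subseteq \mathbb{Z}_n$, its density is $r(A) := |A|/n$, where $|A|$ is the number of elements of $A$. The limits are taken over positive integers $n$. *)

theory Defs
  imports "HOL-Number_Theory.Residues" "HOL-Library.Liminf_Limsup" "HOL-Library.Extended_Real"
begin

definition sum_two_squares_mod :: "nat \<Rightarrow> int set" where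
  "sum_two_squares_mod n =
     {m \<in> carrier (residue_ring (int n)).
        \<exists>x \<in> carrier (residue_ring (int n)). \<exists>y \<in> carrier (residue_ring (int n)).
          m = x [^]\<^bsub>residue_ring (int n)\<^esub> (2::nat)
                \<oplus>\<^bsub>residue_ring (int n)\<^esub> y [^]\<^bsub>residue_ring (int n)\<^esub> (2::nat)}"

definition not_sum_two_squares_mod :: "nat \<Rightarrow> int set" where
  "not_sum_two_squares_mod n = carrier (residue_ring (int n)) - sum_two_squares_mod n"

(* The modulus is an explicit argument because a subset of the integers
   {0..n-1} does not determine n. *)
definition residue_density :: "nat \<Rightarrow> int set \<Rightarrow> real" where
  "residue_density n A = real (card A) / real n"

end

theory Submission
  imports Defs "HOL-Analysis.Harmonic_Numbers"
begin

text \<open>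
  For an odd prime \<open>p\<close> every residue is a sum of two squares, by the pigeonhole principle, so the
  density 1 is attained infinitely often. For a prime \<open>p\<close> congruent to 3 modulo 4, a sum of two
  squares divisible by \<open>p\<close> is divisible by \<open>p\<^sup>2\<close>, so modulo \<open>p\<^sup>2\<close> the \<open>p - 1\<close> nonzero multiples
  of \<open>p\<close> are missed; by the Chinese remainder theorem the density modulo the product of these \<open>p\<^sup>2\<close>
  is at most the product of the factors \<open>1 - (p - 1) / p\<^sup>2\<close>.

  This product tends to 0 because the product of \<open>(p + 1) / (p - 1)\<close> over the primes \<open>p \<equiv> 3\<close> mod 4
  diverges. To see this without Dirichlet series, start with the character \<open>\<chi>\<close> modulo 4, whose
  partial sums of \<open>\<chi>(n) / n\<close> are bounded by 1, and change its value at one prime \<open>p \<equiv> 3\<close> after the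
  other from \<open>-1\<close> to \<open>1\<close>. Each change multiplies the uniform bound on the partial sums by at most
  \<open>(p + 1) / (p - 1)\<close>, and after all changes up to \<open>x\<close> the partial sum up to \<open>x\<close> is the sum of
  \<open>1 / n\<close> over odd \<open>n\<close>.
\<close>

section \<open>Logarithmic sums and a change of sign at one prime\<close>

definition log_sum :: "(nat \<Rightarrow> real) \<Rightarrow> nat \<Rightarrow> real" where
  "log_sum f x = (\<Sum>n=1..x. f n / real n)"

lemma log_sum_split:
  assumes "p > 0"
  shows "log_sum f x = (\<Sum>n\<in>{n\<in>{1..x}. \<not> p dvd n}. f n / real n)
           + log_sum (\<lambda>n. f (p * n)) (x div p) / real p"
proof -
  have "{n\<in>{1..x}. p dvd n} = (\<lambda>n. p * n) ` {1..x div p}"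
  proof (intro equalityI subsetI)
    fix n assume "n \<in> {n\<in>{1..x}. p dvd n}"
    then obtain k where k: "n = p * k" "1 \<le> n" "n \<le> x" by (auto elim: dvdE)
    with assms have "k \<in> {1..x div p}"
      by (auto simp: less_eq_div_iff_mult_less_eq mult.commute Suc_le_eq)
    with k show "n \<in> (\<lambda>n. p * n) ` {1..x div p}" by auto
  next
    fix n assume "n \<in> (\<lambda>n. p * n) ` {1..x div p}"
    with assms show "n \<in> {n\<in>{1..x}. p dvd n}"
      by (auto simp: less_eq_div_iff_mult_less_eq mult.commute)
  qed
  then have "(\<Sum>n\<in>{n\<in>{1..x}. p dvd n}. f n / real n) = (\<Sum>n=1..x div p. f (p * n) / real (p * n))"
    using assms by (simp add: sum.reindex inj_on_def)
  also have "\<dots> = log_sum (\<lambda>n. f (p * n)) (x div p) / real p"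
    unfolding log_sum_def sum_divide_distrib by (simp add: mult.commute)
  finally have mult: "(\<Sum>n\<in>{n\<in>{1..x}. p dvd n}. f n / real n) = \<dots>" .
  have "log_sum f x = (\<Sum>n\<in>{n\<in>{1..x}. \<not> p dvd n} \<union> {n\<in>{1..x}. p dvd n}. f n / real n)"
    unfolding log_sum_def by (rule sum.cong) auto
  also have "\<dots> = (\<Sum>n\<in>{n\<in>{1..x}. \<not> p dvd n}. f n / real n)
      + (\<Sum>n\<in>{n\<in>{1..x}. p dvd n}. f n / real n)"
    by (rule sum.union_disjoint) auto
  finally show ?thesis unfolding mult .
qed

text \<open>Write \<open>F\<close> and \<open>G\<close> for the logarithmic sums of \<open>f\<close>
  and \<open>g\<close>. Splitting off the multiples of \<open>p\<close> in both, where the remaining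
  parts agree, gives \<open>G x = G (x div p) / p + F x + F (x div p) / p\<close>, and strong
  induction on \<open>x\<close> applies.\<close>

lemma log_sum_flip_bound:
  assumes p: "p \<ge> 2"
    and f: "\<And>n. n > 0 \<Longrightarrow> f (p * n) = - f n"
    and g: "\<And>n. n > 0 \<Longrightarrow> g (p * n) = g n"
    and eq: "\<And>n. \<not> p dvd n \<Longrightarrow> g n = f n"
    and bound: "\<And>x. \<bar>log_sum f x\<bar> \<le> C"
  shows "\<bar>log_sum g x\<bar> \<le> C * ((real p + 1) / (real p - 1))"
proof (induction x rule: less_induct)
  case (less x)
  define D where "D = C * ((real p + 1) / (real p - 1))"
  have "C \<ge> 0" using bound[of 0] by (simp add: log_sum_def)
  \<comment> \<open>\<open>D\<close> is the constant that the recursion reproduces.\<close>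
  have D: "D = D / p + C + C / p" using p by (simp add: D_def field_simps)
  have "log_sum (\<lambda>n. f (p * n)) y = - log_sum f y"
       "log_sum (\<lambda>n. g (p * n)) y = log_sum g y" for y
    unfolding log_sum_def by (simp_all add: f g sum_negf)
  then have rec: "log_sum g x = log_sum g (x div p) / p + log_sum f x + log_sum f (x div p) / p"
    using log_sum_split[of p f x] log_sum_split[of p g x] p by (simp add: eq)
  have 1: "\<bar>log_sum g (x div p)\<bar> \<le> D"
  proof (cases "x = 0")
    case True
    with \<open>C \<ge> 0\<close> p show ?thesis by (simp add: log_sum_def D_def)
  next
    case False
    then have "x div p < x" using p by simp
    from less[OF this] show ?thesis by (simp add: D_def)
  qed
  have "\<bar>log_sum g x\<bar> \<le> \<bar>log_sum g (x div p)\<bar> / p + \<bar>log_sum f x\<bar> + \<bar>log_sum f (x div p)\<bar> / p"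
    unfolding rec using p abs_triangle_ineq[of "log_sum g (x div p) / p + log_sum f x" "log_sum f (x div p) / p"]
      abs_triangle_ineq[of "log_sum g (x div p) / p" "log_sum f x"]
    by (simp add: abs_divide)
  also have "\<dots> \<le> D / p + C + C / p"
    by (intro add_mono divide_right_mono 1 bound) auto
  finally show ?case using D by (simp add: D_def)
qed

section \<open>The character modulo 4\<close>

definition chi4 :: "nat \<Rightarrow> real" where
  "chi4 n = (if even n then 0 else if n mod 4 = 1 then 1 else -1)"

lemma chi4_mod: "chi4 (n mod 4) = chi4 n"
  by (simp add: chi4_def dvd_mod_iff)

lemma chi4_mult: "chi4 (m * n) = chi4 m * chi4 n"
proof -
  have mod4: "k mod 4 \<in> {0, 1, 2, 3}" for k :: nat by simp linarith
  have "chi4 (m * n) = chi4 ((m mod 4) * (n mod 4) mod 4)"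
    by (simp add: chi4_mod mod_mult_eq)
  also have "\<dots> = chi4 (m mod 4) * chi4 (n mod 4)"
    using mod4[of m] mod4[of n] by (auto simp: chi4_def)
  finally show ?thesis by (simp add: chi4_mod)
qed

lemma log_sum_Suc: "log_sum f (Suc x) = log_sum f x + f (Suc x) / real (Suc x)"
  by (simp add: log_sum_def)

text \<open>The nonzero terms 1, -1/3, 1/5, ... alternate and decrease in size, so the partial sums
  stay between 0 and 1.\<close>

lemma log_sum_chi4_bound: "\<bar>log_sum chi4 x\<bar> \<le> 1"
proof -
  have chi: "chi4 (Suc (4 * k)) = 1" "chi4 (Suc (Suc (4 * k))) = 0"
    "chi4 (Suc (Suc (Suc (4 * k)))) = -1" "chi4 (Suc (Suc (Suc (Suc (4 * k))))) = 0" for k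
    by (simp_all add: chi4_def mod_Suc)
  \<comment> \<open>The margin \<open>1 / (4 * real k + 1)\<close> carries the induction and leaves
    room for the next positive term.\<close>
  have *: "0 \<le> log_sum chi4 (4 * k) \<and> log_sum chi4 (4 * k) \<le> 1 - 1 / (4 * real k + 1)" for k
  proof (induction k)
    case 0
    show ?case by (simp add: log_sum_def)
  next
    case (Suc k)
    have eq: "4 * Suc k = Suc (Suc (Suc (Suc (4 * k))))" by simp
    have "log_sum chi4 (4 * Suc k) = log_sum chi4 (4 * k) + 1 / (4 * real k + 1) - 1 / (4 * real k + 3)"
      unfolding eq log_sum_Suc chi by (simp add: algebra_simps)
    moreover have "1 / (4 * real k + 3) \<le> 1 / (4 * real k + 1)" 
      "1 / (4 * real (Suc k) + 1) \<le> 1 / (4 * real k + 3)" by (simp_all add: frac_le)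
    ultimately show ?case using Suc by linarith
  qed
  define k where "k = x div 4"
  have "x = 4 * k \<or> x = Suc (4 * k) \<or> x = Suc (Suc (4 * k)) \<or> x = Suc (Suc (Suc (4 * k)))"
    unfolding k_def by presburger
  moreover have "1 / (4 * real k + 3) \<le> 1 / (4 * real k + 1)" "1 / (4 * real k + 1) \<ge> 0"
    by (simp_all add: frac_le)
  moreover have "log_sum chi4 (4 * k) \<le> 1"
    "log_sum chi4 (4 * k) + (1 / (4 * real k + 1) - 1 / (4 * real k + 3)) \<le> 1"
    using *[of k] calculation(2,3) divide_nonneg_nonneg[of 1 "4 * real k + 3"] by linarith+
  ultimately show ?thesis using *[of k]
    by (elim disjE conjE; simp add: log_sum_Suc chi add_ac abs_le_iff)
qed

section \<open>Sign changes at the primes congruent to 3 modulo 4\<close>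

text \<open>The completely multiplicative function that arises from \<open>chi4\<close> by changing its sign at the
  primes in \<open>P\<close>.\<close>

definition twist :: "nat set \<Rightarrow> nat \<Rightarrow> real" where
  "twist P n = chi4 n * (\<Prod>p\<in>P. (-1) ^ multiplicity p n)"

lemma twist_mult:
  assumes "\<And>p. p \<in> P \<Longrightarrow> prime p" "m > 0" "n > 0"
  shows "twist P (m * n) = twist P m * twist P n"
proof -
  have "(\<Prod>p\<in>P. (-1::real) ^ multiplicity p (m * n)) = (\<Prod>p\<in>P. (-1) ^ multiplicity p m * (-1) ^ multiplicity p n)"
    using assms by (intro prod.cong) (auto simp: prime_elem_multiplicity_mult_distrib power_add)
  then show ?thesis by (simp add: twist_def chi4_mult prod.distrib)
qed

lemma twist_prime:
  assumes "finite P" "\<And>p. p \<in> P \<Longrightarrow> prime p" "prime q"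
  shows "twist P q = (if q \<in> P then - chi4 q else chi4 q)"
proof -
  have "(\<Prod>p\<in>P. (-1::real) ^ multiplicity p q) = (\<Prod>p\<in>P. if p = q then -1 else 1)"
    using assms by (intro prod.cong) (auto simp: prime_multiplicity_other)
  also have "\<dots> = (if q \<in> P then -1 else 1)"
    using assms(1) by (simp add: prod.delta)
  finally show ?thesis by (simp add: twist_def)
qed

text \<open>Inserting \<open>p\<close> into \<open>P\<close> changes the value at \<open>p\<close>
  from \<open>-1\<close> to \<open>1\<close>, which costs one factor by
  \<open>log_sum_flip_bound\<close>. The induction starts from \<open>chi4\<close> with bound
  1.\<close>

lemma log_sum_twist_bound:
  assumes "finite P" "\<And>p. p \<in> P \<Longrightarrow> prime p \<and> p mod 4 = 3"
  shows "\<bar>log_sum (twist P) x\<bar> \<le> (\<Prod>p\<in>P. (real p + 1) / (real p - 1))"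
  using assms
proof (induction P arbitrary: x rule: finite_induct)
  case empty
  have "twist {} = chi4" by (simp add: twist_def fun_eq_iff)
  with log_sum_chi4_bound show ?case by simp
next
  case (insert p P)
  have p: "prime p" "p mod 4 = 3" and P: "\<And>q. q \<in> insert p P \<Longrightarrow> prime q"
    using insert.prems by auto
  have "odd p" using p(2) by presburger
  then have chi: "chi4 p = -1" using p(2) by (simp add: chi4_def)
  have pos: "p > 0" using p(1) prime_gt_0_nat by blast
  have "\<bar>log_sum (twist (insert p P)) x\<bar> \<le>
      (\<Prod>p\<in>P. (real p + 1) / (real p - 1)) * ((real p + 1) / (real p - 1))"
  proof (rule log_sum_flip_bound[where f = "twist P"])
    show "2 \<le> p" using p(1) by (rule prime_ge_2_nat)
    show "twist P (p * n) = - twist P n" if "n > 0" for n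
      using that pos P p insert.hyps chi by (simp add: twist_mult twist_prime)
    show "twist (insert p P) (p * n) = twist (insert p P) n" if "n > 0" for n
    proof -
      have "twist (insert p P) p = 1"
        using twist_prime[of "insert p P", OF _ P p(1)] insert.hyps chi by simp
      then show ?thesis using twist_mult[of "insert p P", OF P pos that] by simp
    qed
    show "twist (insert p P) n = twist P n" if "\<not> p dvd n" for n
      using insert.hyps that by (simp add: twist_def not_dvd_imp_multiplicity_0)
    show "\<bar>log_sum (twist P) x\<bar> \<le> (\<Prod>p\<in>P. (real p + 1) / (real p - 1))" for x
      using insert by auto
  qed
  then show ?case using insert.hyps by (simp add: mult.commute)
qed

definition primes_3_mod_4 :: "nat \<Rightarrow> nat set" where
  "primes_3_mod_4 x = {p. prime p \<and> p mod 4 = 3 \<and> p \<le> x}"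

lemma finite_primes_3_mod_4: "finite (primes_3_mod_4 x)"
  by (rule finite_subset[of _ "{..x}"]) (auto simp: primes_3_mod_4_def)

text \<open>By multiplicativity only the prime factors of an odd \<open>n\<close> matter. Those
  congruent to 1 modulo 4 keep the value 1, and those congruent to 3 are at most \<open>x\<close>
  and hence have been changed to 1.\<close>

lemma twist_primes_3_mod_4:
  assumes "n > 0" "n \<le> x"
  shows "twist (primes_3_mod_4 x) n = (if even n then 0 else 1)"
  using assms
proof (induction n rule: less_induct)
  case (less n)
  have prime: "\<And>p. p \<in> primes_3_mod_4 x \<Longrightarrow> prime p" by (simp add: primes_3_mod_4_def)
  show ?case
  proof (cases "even n \<or> n = 1")
    case True
    then show ?thesis by (auto simp: twist_def chi4_def)
  next
    case False
    then obtain q where q: "prime q" "q dvd n" using prime_factor_nat by blast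
    then obtain m where m: "n = q * m" by (auto elim: dvdE)
    have "m > 0" "q > 0" using m less.prems by (auto intro: Nat.gr0I)
    have "odd q" "odd m" using m False by auto
    have "m < n" using m \<open>m > 0\<close> q prime_gt_1_nat by simp
    have "q \<le> n" using m \<open>m > 0\<close> by simp
    then have "q \<le> x" using less.prems by simp
    have "q mod 4 = 1 \<or> q mod 4 = 3" using \<open>odd q\<close> by presburger
    then have "twist (primes_3_mod_4 x) q = 1"
      using \<open>odd q\<close> \<open>q \<le> x\<close> q(1) twist_prime[OF finite_primes_3_mod_4 prime q(1)]
      by (auto simp: chi4_def primes_3_mod_4_def)
    moreover have "twist (primes_3_mod_4 x) m = 1"
      using less.IH[of m] \<open>m < n\<close> \<open>m > 0\<close> \<open>odd m\<close> less.prems by simp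
    ultimately show ?thesis
      using False twist_mult[OF prime \<open>q > 0\<close> \<open>m > 0\<close>] by (simp add: m)
  qed
qed

text \<open>The odd terms carry at least half of the harmonic sum, and up to \<open>x\<close> the
  twisted sum consists of exactly these terms. Divergence of the harmonic series thus passes to the
  product.\<close>

lemma harm_le_prod_primes_3_mod_4:
  "harm x / 2 \<le> (\<Prod>p\<in>primes_3_mod_4 x. (real p + 1) / (real p - 1))"
proof -
  let ?odd = "\<lambda>n::nat. if even n then 0 else 1 :: real"
  have harm: "log_sum (\<lambda>_. 1) y = harm y" for y
    by (simp add: log_sum_def harm_def inverse_eq_divide)
  \<comment> \<open>The even terms are 0, so the second part of the split vanishes.\<close>
  have "log_sum ?odd x = (\<Sum>n\<in>{n\<in>{1..x}. \<not> 2 dvd n}. ?odd n / real n)"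
    using log_sum_split[of 2 ?odd x] by (simp add: log_sum_def)
  also have "\<dots> = (\<Sum>n\<in>{n\<in>{1..x}. \<not> 2 dvd n}. 1 / real n)"
    by (rule sum.cong) auto
  also have "\<dots> = harm x - harm (x div 2) / 2"
    using log_sum_split[of 2 "\<lambda>_. 1" x] by (simp add: harm)
  also have "\<dots> \<ge> harm x / 2"
    using harm_mono[of "x div 2" x, where ?'a = real] by simp
  finally have "harm x / 2 \<le> log_sum ?odd x" .
  also have "log_sum ?odd x = log_sum (twist (primes_3_mod_4 x)) x"
    unfolding log_sum_def by (rule sum.cong) (auto simp: twist_primes_3_mod_4)
  also have "\<dots> \<le> (\<Prod>p\<in>primes_3_mod_4 x. (real p + 1) / (real p - 1))"
    using log_sum_twist_bound[OF finite_primes_3_mod_4, of x x] by (auto simp: primes_3_mod_4_def)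
  finally show ?thesis .
qed

section \<open>Sums of two squares modulo \<open>n\<close> and coprime moduli\<close>

text \<open>Frees \<open>x\<close> and \<open>y\<close> from their range and from the ring
  operations, so that integer congruences can be used below.\<close>

lemma sum_two_squares_mod_eq:
  assumes "n > 0"
  shows "sum_two_squares_mod n = {m \<in> {0..<int n}. \<exists>x y. m = (x\<^sup>2 + y\<^sup>2) mod int n}"
proof -
  have pow: "x [^]\<^bsub>residue_ring (int n)\<^esub> (2::nat) = x\<^sup>2 mod int n" for x
    by (simp add: residue_ring_def nat_pow_def numeral_2_eq_2 mod_mult_left_eq)
  have "(\<exists>x \<in> {0..int n - 1}. \<exists>y \<in> {0..int n - 1}. m = (x\<^sup>2 mod int n + y\<^sup>2 mod int n) mod int n)
      \<longleftrightarrow> (\<exists>x y. m = (x\<^sup>2 + y\<^sup>2) mod int n)" for m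
  proof
    assume "\<exists>x y. m = (x\<^sup>2 + y\<^sup>2) mod int n"
    then obtain x y where "m = (x\<^sup>2 + y\<^sup>2) mod int n" by blast
    then have "m = ((x mod int n)\<^sup>2 mod int n + (y mod int n)\<^sup>2 mod int n) mod int n"
      by (simp add: power_mod mod_add_eq)
    moreover have "z mod int n \<in> {0..int n - 1}" for z using assms by simp
    ultimately show "\<exists>x \<in> {0..int n - 1}. \<exists>y \<in> {0..int n - 1}. m = (x\<^sup>2 mod int n + y\<^sup>2 mod int n) mod int n"
      by blast
  qed (auto simp: mod_add_eq)
  then show ?thesis
    unfolding sum_two_squares_mod_def pow by (auto simp: residue_ring_def)
qed

lemma finite_sum_two_squares_mod: "finite (sum_two_squares_mod n)"
  by (rule finite_subset[of _ "{0..int n - 1}"]) (auto simp: sum_two_squares_mod_def residue_ring_def)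

lemma card_sum_two_squares_mod_le: "card (sum_two_squares_mod n) \<le> n"
proof -
  have "card (sum_two_squares_mod n) \<le> card {0..int n - 1}"
    by (rule card_mono) (auto simp: sum_two_squares_mod_def residue_ring_def)
  then show ?thesis by simp
qed

lemma card_sum_two_squares_mod_pos:
  assumes "n > 0"
  shows "card (sum_two_squares_mod n) > 0"
proof -
  have "0 \<in> sum_two_squares_mod n"
    using assms by (auto simp: sum_two_squares_mod_eq intro!: exI[of _ 0])
  then show ?thesis using finite_sum_two_squares_mod card_gt_0_iff by blast
qed

text \<open>Chinese remainder theorem: the pair of residues modulo \<open>a\<close> and
  \<open>b\<close> determines the residue modulo \<open>a * b\<close>, and the same \<open>x\<close>
  and \<open>y\<close> serve for all three moduli.\<close>

lemma card_sum_two_squares_mod_mult_le: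
  assumes "coprime a b" "a > 0" "b > 0"
  shows "card (sum_two_squares_mod (a * b)) \<le> card (sum_two_squares_mod a) * card (sum_two_squares_mod b)"
proof -
  let ?f = "\<lambda>m. (m mod int a, m mod int b)"
  have "inj_on ?f (sum_two_squares_mod (a * b))"
  proof (rule inj_onI)
    fix m n assume mn: "m \<in> sum_two_squares_mod (a * b)" "n \<in> sum_two_squares_mod (a * b)" "?f m = ?f n"
    then have "[m = n] (mod int a)" "[m = n] (mod int b)" by (simp_all add: cong_def)
    moreover have "coprime (int a) (int b)" using assms by simp
    ultimately have "[m = n] (mod int a * int b)" by (rule coprime_cong_mult)
    then show "m = n" using mn assms by (simp add: sum_two_squares_mod_eq cong_def)
  qed
  moreover have "?f ` sum_two_squares_mod (a * b) \<subseteq> sum_two_squares_mod a \<times> sum_two_squares_mod b"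
    using assms by ((auto simp: sum_two_squares_mod_eq mod_mod_cancel); blast)
  ultimately have "card (sum_two_squares_mod (a * b)) \<le> card (sum_two_squares_mod a \<times> sum_two_squares_mod b)"
    by (meson card_inj_on_le finite_SigmaI finite_sum_two_squares_mod)
  then show ?thesis by (simp add: card_cartesian_product)
qed

lemma card_sum_two_squares_mod_prod_le:
  assumes "finite P" "\<And>p. p \<in> P \<Longrightarrow> prime p"
  shows "card (sum_two_squares_mod (\<Prod>p\<in>P. p\<^sup>2)) \<le> (\<Prod>p\<in>P. card (sum_two_squares_mod (p\<^sup>2)))"
  using assms
proof (induction P rule: finite_induct)
  case empty
  show ?case using card_sum_two_squares_mod_le[of 1] by simp
next
  case (insert p P)
  have "coprime (p\<^sup>2) (\<Prod>q\<in>P. q\<^sup>2)"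
    using insert by (intro prod_coprime_right) (auto intro!: primes_coprime)
  moreover have "(\<Prod>q\<in>P. q\<^sup>2) > 0" "p\<^sup>2 > 0"
    using insert.prems by (auto intro!: prod_pos simp: prime_gt_0_nat)
  ultimately have "card (sum_two_squares_mod (p\<^sup>2 * (\<Prod>q\<in>P. q\<^sup>2)))
      \<le> card (sum_two_squares_mod (p\<^sup>2)) * card (sum_two_squares_mod (\<Prod>q\<in>P. q\<^sup>2))"
    by (intro card_sum_two_squares_mod_mult_le)
  also have "\<dots> \<le> card (sum_two_squares_mod (p\<^sup>2)) * (\<Prod>p\<in>P. card (sum_two_squares_mod (p\<^sup>2)))"
    using insert by (intro mult_left_mono) auto
  finally show ?case using insert.hyps by simp
qed

section \<open>Prime and prime-square moduli\<close>

text \<open>Otherwise \<open>p\<close> divides neither \<open>a\<close> nor \<open>b\<close>, and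
  raising \<open>a^2 \<equiv> -b^2\<close> to the odd power \<open>(p - 1) / 2\<close> gives
  \<open>1 \<equiv> -1\<close> by Fermat's little theorem.\<close>

lemma prime_3_mod_4_dvd_sum_squares_nat:
  fixes a b p :: nat
  assumes p: "prime p" "p mod 4 = 3" and dvd: "p dvd a\<^sup>2 + b\<^sup>2"
  shows "p dvd a"
proof (rule ccontr)
  assume a: "\<not> p dvd a"
  have b: "\<not> p dvd b"
  proof
    assume "p dvd b"
    then have "p dvd b\<^sup>2" by (simp add: power2_eq_square)
    with dvd have "p dvd a\<^sup>2" by (simp add: dvd_add_left_iff)
    with p(1) a show False using prime_dvd_power[of p a 2] by simp
  qed
  define k where "k = (p - 1) div 2"
  \<comment> \<open>For \<open>p = 4 * j + 3\<close> this is \<open>k = 2 * j + 1\<close>; oddness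
    lets the minus sign survive the \<open>k\<close>-th power.\<close>
  have k: "2 * k = p - 1" "odd k" using p(2) unfolding k_def by presburger+
  have "int p dvd int a ^ 2 - (- (int b ^ 2))"
    using dvd by (simp flip: of_nat_power of_nat_add)
  then have "[int a ^ 2 = - (int b ^ 2)] (mod int p)" by (simp add: cong_iff_dvd_diff)
  then have "[(int a ^ 2) ^ k = (- (int b ^ 2)) ^ k] (mod int p)" by (rule cong_pow)
  then have ab: "[int a ^ (p - 1) = - (int b ^ (p - 1))] (mod int p)"
    using k by (simp flip: power_mult)
  have "[a ^ (p - 1) = 1] (mod p)" "[b ^ (p - 1) = 1] (mod p)"
    using fermat_theorem[OF p(1) a] fermat_theorem[OF p(1) b] .
  then have "[int (a ^ (p - 1)) = int 1] (mod int p)" "[int (b ^ (p - 1)) = int 1] (mod int p)"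
    by (simp_all only: cong_int_iff)
  then have fermat: "[int a ^ (p - 1) = 1] (mod int p)" "[int b ^ (p - 1) = 1] (mod int p)"
    by simp_all
  have "[1 = - (int b ^ (p - 1))] (mod int p)"
    using cong_trans[OF cong_sym[OF fermat(1)] ab] .
  also have "[- (int b ^ (p - 1)) = - 1] (mod int p)"
    using fermat(2) by (simp only: cong_minus_minus_iff)
  finally have "[1 = - (1::int)] (mod int p)" .
  then have "int p dvd 2" by (simp add: cong_iff_dvd_diff)
  then have "int p \<le> 2" by (rule zdvd_imp_le) simp
  moreover have "p \<ge> 3" using mod_less_eq_dividend[of p 4] p(2) by simp
  ultimately show False by simp
qed

text \<open>The version for naturals, applied to the absolute values in both orders, makes
  \<open>p\<close> divide \<open>x\<close> and \<open>y\<close>.\<close>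

lemma prime_3_mod_4_dvd_sum_squares:
  fixes x y :: int
  assumes p: "prime p" "p mod 4 = 3" and dvd: "int p dvd x\<^sup>2 + y\<^sup>2"
  shows "(int p)\<^sup>2 dvd x\<^sup>2 + y\<^sup>2"
proof -
  have "int p dvd int ((nat \<bar>x\<bar>)\<^sup>2 + (nat \<bar>y\<bar>)\<^sup>2)" using dvd by simp
  then have d: "p dvd (nat \<bar>x\<bar>)\<^sup>2 + (nat \<bar>y\<bar>)\<^sup>2" by (simp only: of_nat_dvd_iff)
  then have "p dvd nat \<bar>x\<bar>" "p dvd nat \<bar>y\<bar>"
    using prime_3_mod_4_dvd_sum_squares_nat[OF p d]
      prime_3_mod_4_dvd_sum_squares_nat[OF p d[unfolded add.commute[of "(nat \<bar>x\<bar>)\<^sup>2"]]] by blast+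
  then have "int p dvd x" "int p dvd y" by (simp_all add: nat_abs_dvd_iff dvd_nat_abs_iff)
  then show ?thesis by (simp add: dvd_power_same)
qed

text \<open>A nonzero multiple of \<open>p\<close> below \<open>p^2\<close> cannot be a residue of
  \<open>x^2 + y^2\<close>: divisibility of that sum by \<open>p\<close> forces divisibility by
  \<open>p^2\<close>, hence residue 0.\<close>

lemma card_sum_two_squares_mod_prime_square_le:
  assumes p: "prime p" "p mod 4 = 3"
  shows "card (sum_two_squares_mod (p\<^sup>2)) \<le> p\<^sup>2 - (p - 1)"
proof -
  let ?M = "(\<lambda>k. int p * k) ` {1..<int p}"
  have pos: "p > 0" using p prime_gt_0_nat by blast
  have M: "?M \<subseteq> {0..<int (p\<^sup>2)}" using pos by (auto simp: power2_eq_square)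
  have "sum_two_squares_mod (p\<^sup>2) \<subseteq> {0..<int (p\<^sup>2)} - ?M"
  proof
    fix m assume m: "m \<in> sum_two_squares_mod (p\<^sup>2)"
    then obtain x y where xy: "m \<in> {0..<int (p\<^sup>2)}" "m = (x\<^sup>2 + y\<^sup>2) mod int (p\<^sup>2)"
      using pos by (auto simp: sum_two_squares_mod_eq)
    have "m \<notin> ?M"
    proof
      assume "m \<in> ?M"
      then obtain k where k: "m = int p * k" "1 \<le> k" "k < int p" by auto
      have "int p dvd (x\<^sup>2 + y\<^sup>2) mod int (p\<^sup>2)" using k xy by simp
      then have "int p dvd x\<^sup>2 + y\<^sup>2" by (simp add: dvd_mod_iff power2_eq_square)
      then have "(int p)\<^sup>2 dvd x\<^sup>2 + y\<^sup>2" by (rule prime_3_mod_4_dvd_sum_squares[OF p])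
      then have "m = 0" using xy by simp
      with k pos show False by simp
    qed
    with xy show "m \<in> {0..<int (p\<^sup>2)} - ?M" by simp
  qed
  then have "card (sum_two_squares_mod (p\<^sup>2)) \<le> card ({0..<int (p\<^sup>2)} - ?M)"
    by (rule card_mono[rotated]) simp
  also have "\<dots> = card {0..<int (p\<^sup>2)} - card ?M"
    using M by (intro card_Diff_subset) auto
  also have "card ?M = p - 1"
    using pos by (subst card_image) (auto simp: inj_on_def)
  finally show ?thesis by (simp only: card_atLeastLessThan_int diff_zero nat_int)
qed

text \<open>Pigeonhole: \<open>x^2\<close> and \<open>m - y^2\<close>, for \<open>x\<close> and
  \<open>y\<close> from 0 to \<open>(p - 1) / 2\<close>, take \<open>(p + 1) / 2\<close> residues
  each, together more than \<open>p\<close>, so they share a value.\<close>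

lemma card_sum_two_squares_mod_prime:
  assumes p: "prime p" "odd p"
  shows "card (sum_two_squares_mod p) = p"
proof -
  define h where "h = (int p - 1) div 2"
  have h: "2 * h = int p - 1" using p(2) unfolding h_def by presburger
  have pos: "p > 0" using p prime_gt_0_nat by blast
  \<comment> \<open>On this range \<open>x + y\<close> and \<open>x - y\<close> are less than
    \<open>p\<close> in absolute value, so a multiple of \<open>p\<close> among them is 0;
    \<open>x + y = 0\<close> forces \<open>x = y = 0\<close>.\<close>
  have inj: "x = y" if xy: "x \<in> {0..h}" "y \<in> {0..h}" and "int p dvd x\<^sup>2 - y\<^sup>2" for x y
  proof -
    have "int p dvd (x - y) * (x + y)" using that by (simp add: power2_eq_square algebra_simps)
    then consider "int p dvd x - y" | "int p dvd x + y"
      using p(1) by (auto simp: prime_dvd_mult_iff)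
    then show ?thesis
    proof cases
      case 1
      then show ?thesis using xy h dvd_imp_le_int[of "x - y" "int p"] by (cases "x - y = 0") auto
    next
      case 2
      then show ?thesis using xy h dvd_imp_le_int[of "x + y" "int p"] by (cases "x + y = 0") auto
    qed
  qed
  have "sum_two_squares_mod p = {0..<int p}"
  proof (intro equalityI subsetI)
    fix m assume m: "m \<in> {0..<int p}"
    let ?A = "(\<lambda>x. x\<^sup>2 mod int p) ` {0..h}" and ?B = "(\<lambda>y. (m - y\<^sup>2) mod int p) ` {0..h}"
    have "inj_on (\<lambda>x. x\<^sup>2 mod int p) {0..h}"
      by (rule inj_onI) (auto intro: inj simp: mod_eq_dvd_iff)
    then have A: "card ?A = nat (h + 1)" by (simp add: card_image)
    have "inj_on (\<lambda>y. (m - y\<^sup>2) mod int p) {0..h}"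
      by (rule inj_onI) (auto intro!: inj[symmetric] simp: mod_eq_dvd_iff)
    then have B: "card ?B = nat (h + 1)" by (simp add: card_image)
    have "?A \<inter> ?B \<noteq> {}"
    proof
      assume "?A \<inter> ?B = {}"
      then have "card (?A \<union> ?B) = nat (h + 1) + nat (h + 1)"
        by (simp add: card_Un_disjoint A B)
      moreover have "card (?A \<union> ?B) \<le> card {0..<int p}"
        using pos by (intro card_mono) auto
      ultimately show False using h pos by simp
    qed
    then obtain x y where "x\<^sup>2 mod int p = (m - y\<^sup>2) mod int p" by auto
    from mod_add_cong[OF this refl, of "y\<^sup>2"] have "(x\<^sup>2 + y\<^sup>2) mod int p = m mod int p"
      by simp
    then have "m = (x\<^sup>2 + y\<^sup>2) mod int p" using m by simp
    then show "m \<in> sum_two_squares_mod p" using m pos by (auto simp: sum_two_squares_mod_eq)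
  qed (use pos in \<open>simp add: sum_two_squares_mod_eq\<close>)
  then show ?thesis by simp
qed

section \<open>Moduli of small and of full density\<close>

text \<open>Links the local density bound to the divergent product. With
  \<open>y = (p - 1) / p^2\<close>, Bernoulli gives
  \<open>(p + 1) / (p - 1) \<le> 1 + 6 * y \<le> (1 + y)^6\<close>, and
  \<open>(1 - y) * (1 + y) \<le> 1\<close>.\<close>

lemma one_minus_pow_le:
  fixes p :: real
  assumes "p \<ge> 3"
  shows "(1 - (p - 1) / p\<^sup>2) ^ 6 \<le> (p - 1) / (p + 1)"
proof -
  define y where "y = (p - 1) / p\<^sup>2"
  have "1 * p \<le> p * p" using assms by (intro mult_right_mono) auto
  then have "p - 1 \<le> p * p" by simp
  then have y: "0 \<le> y" "y \<le> 1" using assms by (simp_all add: y_def power2_eq_square field_simps)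
  \<comment> \<open>The right side equals \<open>3 * (p - 1)^2 - p^2\<close>; its nonnegativity
    makes the exponent 6 large enough.\<close>
  have "0 \<le> (p - 3) * (2 * p) + 3" using assms by simp
  then have "p\<^sup>2 \<le> 3 * (p - 1)\<^sup>2" by (simp add: power2_eq_square algebra_simps)
  then have "2 / (p - 1) \<le> 6 * y"
    using assms by (simp add: y_def field_simps power2_eq_square)
  then have "(p + 1) / (p - 1) \<le> 1 + 6 * y" using assms by (simp add: field_simps)
  also have "\<dots> \<le> (1 + y) ^ 6" using Bernoulli_inequality[of y 6] y by simp
  finally have ge: "(p + 1) / (p - 1) \<le> (1 + y) ^ 6" .
  have "(1 - y) ^ 6 * ((p + 1) / (p - 1)) \<le> (1 - y) ^ 6 * (1 + y) ^ 6"
    using ge by (rule mult_left_mono) simp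
  also have "\<dots> = (1 - y\<^sup>2) ^ 6"
    unfolding power_mult_distrib[symmetric] by (simp add: algebra_simps power2_eq_square)
  also have "\<dots> \<le> 1" using y by (intro power_le_one) (simp_all add: power_le_one)
  finally show ?thesis using assms by (simp add: y_def field_simps)
qed

lemma residue_density_bounds:
  "0 \<le> residue_density n (sum_two_squares_mod n)" "residue_density n (sum_two_squares_mod n) \<le> 1"
  using card_sum_two_squares_mod_le[of n] by (auto simp: residue_density_def divide_le_eq_1)

text \<open>The sixth power bounds each local factor by \<open>(p - 1) / (p + 1)\<close>, the
  inverse of a factor in \<open>harm_le_prod_primes_3_mod_4\<close>.\<close>

lemma density_sum_two_squares_le_harm:
  assumes "x > 0"
  shows "\<exists>n>0. residue_density n (sum_two_squares_mod n) ^ 6 \<le> 2 / harm x"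
proof (intro exI conjI)
  let ?P = "primes_3_mod_4 x"
  let ?n = "\<Prod>p\<in>?P. p\<^sup>2"
  have P: "prime p" "p mod 4 = 3" "p \<ge> 3" if "p \<in> ?P" for p
    using that mod_less_eq_dividend[of p 4] by (auto simp: primes_3_mod_4_def)
  have pos: "p > 0" if "p \<in> ?P" for p using P(3)[OF that] by simp
  then show "?n > 0" by (auto intro!: prod_pos)
  have "real (card (sum_two_squares_mod ?n)) \<le> (\<Prod>p\<in>?P. real (card (sum_two_squares_mod (p\<^sup>2))))"
    using card_sum_two_squares_mod_prod_le[OF finite_primes_3_mod_4 P(1)]
    by (simp flip: of_nat_prod)
  then have "residue_density ?n (sum_two_squares_mod ?n)
      \<le> (\<Prod>p\<in>?P. real (card (sum_two_squares_mod (p\<^sup>2)))) / (\<Prod>p\<in>?P. real (p\<^sup>2))"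
    unfolding residue_density_def of_nat_prod by (intro divide_right_mono prod_nonneg) auto
  also have "\<dots> = (\<Prod>p\<in>?P. real (card (sum_two_squares_mod (p\<^sup>2))) / real (p\<^sup>2))"
    by (simp add: prod_dividef)
  also have "\<dots> \<le> (\<Prod>p\<in>?P. 1 - (real p - 1) / (real p)\<^sup>2)"
  proof (rule prod_mono)
    fix p assume p: "p \<in> ?P"
    \<comment> \<open>Ensures that the subtraction on naturals in the cardinality bound is not
      truncated.\<close>
    have "p - 1 \<le> p\<^sup>2" using le_square[of p] unfolding power2_eq_square by linarith
    then have "real (card (sum_two_squares_mod (p\<^sup>2))) \<le> (real p)\<^sup>2 - (real p - 1)"
      using card_sum_two_squares_mod_prime_square_le[OF P(1)[OF p] P(2)[OF p]] pos[OF p]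
      by (simp add: of_nat_diff flip: of_nat_power)
    then have "real (card (sum_two_squares_mod (p\<^sup>2))) / (real p)\<^sup>2 \<le> ((real p)\<^sup>2 - (real p - 1)) / (real p)\<^sup>2"
      by (rule divide_right_mono) simp
    also have "\<dots> = 1 - (real p - 1) / (real p)\<^sup>2" using pos[OF p] by (simp add: diff_divide_distrib)
    finally show "0 \<le> real (card (sum_two_squares_mod (p\<^sup>2))) / real (p\<^sup>2) \<and>
      real (card (sum_two_squares_mod (p\<^sup>2))) / real (p\<^sup>2) \<le> 1 - (real p - 1) / (real p)\<^sup>2" by simp
  qed
  finally have "residue_density ?n (sum_two_squares_mod ?n) ^ 6
      \<le> (\<Prod>p\<in>?P. 1 - (real p - 1) / (real p)\<^sup>2) ^ 6"
    using residue_density_bounds by (intro power_mono)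
  also have "\<dots> = (\<Prod>p\<in>?P. (1 - (real p - 1) / (real p)\<^sup>2) ^ 6)" by (simp add: prod_power_distrib)
  also have "\<dots> \<le> (\<Prod>p\<in>?P. (real p - 1) / (real p + 1))"
    using P(3) by (intro prod_mono conjI one_minus_pow_le) auto
  also have "\<dots> = inverse (\<Prod>p\<in>?P. (real p + 1) / (real p - 1))"
    unfolding prod_inversef[symmetric] by simp
  also have "\<dots> \<le> inverse (harm x / 2)"
    using assms harm_le_prod_primes_3_mod_4[of x] harm_pos[of x, where ?'a = real]
    by (intro le_imp_inverse_le) auto
  finally show "residue_density ?n (sum_two_squares_mod ?n) ^ 6 \<le> 2 / harm x" by simp
qed

lemma frequently_density_sum_two_squares_less:
  assumes "e > 0"
  shows "\<exists>\<^sub>F n in sequentially. residue_density n (sum_two_squares_mod n) < e"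
  unfolding frequently_sequentially
proof
  fix N :: nat
  define d where "d = min e (1 / real (Suc N))"
  have d: "d > 0" "d \<le> e" "d \<le> 1 / real (Suc N)" using assms by (auto simp: d_def)
  \<comment> \<open>A harmonic sum this large gives \<open>2 / harm x < d ^ 6\<close>, hence a
    density below \<open>d\<close>.\<close>
  have "eventually (\<lambda>x. harm x > 2 / d ^ 6) sequentially"
    using harm_at_top by (simp add: filterlim_at_top_dense)
  then have "eventually (\<lambda>x. harm x > 2 / d ^ 6 \<and> x > 0) sequentially"
    using eventually_gt_at_top[of 0] by eventually_elim auto
  then obtain x where x: "harm x > 2 / d ^ 6" "x > 0"
    using eventually_happens'[OF sequentially_bot] by blast
  obtain n where n: "n > 0" "residue_density n (sum_two_squares_mod n) ^ 6 \<le> 2 / harm x"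
    using density_sum_two_squares_le_harm[OF x(2)] by blast
  have "2 / harm x < d ^ 6"
    using x d harm_pos[OF x(2), where ?'a = real] by (simp add: field_simps)
  with n have "residue_density n (sum_two_squares_mod n) ^ 6 < d ^ 6" by simp
  then have less: "residue_density n (sum_two_squares_mod n) < d"
    by (rule power_less_imp_less_base) (use d in simp)
  have "1 / real n \<le> residue_density n (sum_two_squares_mod n)"
    using card_sum_two_squares_mod_pos[OF n(1)]
    unfolding residue_density_def by (intro divide_right_mono) auto
  then have "1 / real n < 1 / real (Suc N)" using less d by linarith
  \<comment> \<open>A small density forces a large modulus, since 0 is always a sum of two squares.\<close>
  then have "n \<ge> N" using n(1) by (simp add: field_simps)
  with less d show "\<exists>n\<ge>N. residue_density n (sum_two_squares_mod n) < e" by force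
qed

lemma frequently_density_sum_two_squares_eq_1:
  "\<exists>\<^sub>F n in sequentially. residue_density n (sum_two_squares_mod n) = 1"
  unfolding frequently_sequentially
proof
  fix N :: nat
  \<comment> \<open>The offset 2 makes \<open>p\<close> odd as well as larger than
    \<open>N\<close>.\<close>
  obtain p where p: "prime p" "p > N + 2" using bigger_prime by blast
  then have "odd p" using prime_odd_nat by auto
  with p have "residue_density p (sum_two_squares_mod p) = 1"
    by (simp add: residue_density_def card_sum_two_squares_mod_prime)
  with p show "\<exists>n\<ge>N. residue_density n (sum_two_squares_mod n) = 1"
    by (intro exI[of _ p]) simp
qed

text \<open>At \<open>n = 0\<close> both densities are 0, since division by zero yields 0, so the
  identity fails there.\<close>

lemma residue_density_not_sum_two_squares_mod:
  assumes "n > 0"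
  shows "residue_density n (not_sum_two_squares_mod n) = 1 - residue_density n (sum_two_squares_mod n)"
proof -
  have "sum_two_squares_mod n \<subseteq> carrier (residue_ring (int n))"
    by (auto simp: sum_two_squares_mod_def)
  then have "card (not_sum_two_squares_mod n) = n - card (sum_two_squares_mod n)"
    unfolding not_sum_two_squares_mod_def
    by (subst card_Diff_subset) (auto simp: finite_sum_two_squares_mod residue_ring_def)
  then show ?thesis
    using assms card_sum_two_squares_mod_le[of n]
    by (simp add: residue_density_def of_nat_diff diff_divide_distrib)
qed

section \<open>Criteria for the limits inferior and superior\<close>

text \<open>A positive limit inferior would keep \<open>f\<close> above some fixed
  \<open>e > 0\<close> from some index on.\<close>

lemma liminf_eq_0I:
  fixes f :: "nat \<Rightarrow> real"
  assumes "eventually (\<lambda>n. 0 \<le> f n) sequentially"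
    and freq: "\<And>e. e > 0 \<Longrightarrow> \<exists>\<^sub>F n in sequentially. f n < e"
  shows "liminf (\<lambda>n. ereal (f n)) = 0"
proof (rule antisym)
  show "liminf (\<lambda>n. ereal (f n)) \<ge> 0"
    using assms(1) by (intro Liminf_bounded) simp
  show "liminf (\<lambda>n. ereal (f n)) \<le> 0"
  proof (rule ccontr)
    assume "\<not> ?thesis"
    then have "0 < liminf (\<lambda>n. ereal (f n))" by simp
    then obtain e where e: "0 < ereal e" "ereal e < liminf (\<lambda>n. ereal (f n))"
      by (blast dest: ereal_dense2)
    from less_LiminfD[OF e(2)] have "eventually (\<lambda>n. \<not> f n < e) sequentially"
      by (rule eventually_mono) simp
    with freq[of e] e(1) show False by (simp add: frequently_def)
  qed
qed

lemma limsup_eq_1I: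
  fixes f :: "nat \<Rightarrow> real"
  assumes "eventually (\<lambda>n. f n \<le> 1) sequentially"
    and freq: "\<And>e. e > 0 \<Longrightarrow> \<exists>\<^sub>F n in sequentially. 1 - e < f n"
  shows "limsup (\<lambda>n. ereal (f n)) = 1"
proof (rule antisym)
  show "limsup (\<lambda>n. ereal (f n)) \<le> 1"
    using assms(1) by (intro Limsup_bounded) simp
  show "limsup (\<lambda>n. ereal (f n)) \<ge> 1"
  proof (rule ccontr)
    assume "\<not> ?thesis"
    then have "limsup (\<lambda>n. ereal (f n)) < 1" by simp
    then obtain c where c: "ereal c < 1" "limsup (\<lambda>n. ereal (f n)) < ereal c"
      by (blast dest: ereal_dense2)
    \<comment> \<open>The expression \<open>1 - (1 - c)\<close> is \<open>c\<close> in the form that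
      \<open>freq\<close> takes at \<open>1 - c\<close>.\<close>
    from Limsup_lessD[OF c(2)] have "eventually (\<lambda>n. \<not> 1 - (1 - c) < f n) sequentially"
      by (rule eventually_mono) simp
    with freq[of "1 - c"] c(1) show False by (simp add: frequently_def)
  qed
qed

theorem theorem5:
  shows "liminf (\<lambda>n. ereal (residue_density n (sum_two_squares_mod n))) = 0 \<and>
    liminf (\<lambda>n. ereal (residue_density n (not_sum_two_squares_mod n))) = 0 \<and>
    limsup (\<lambda>n. ereal (residue_density n (sum_two_squares_mod n))) = 1 \<and>
    limsup (\<lambda>n. ereal (residue_density n (not_sum_two_squares_mod n))) = 1"
proof -
  have compl: "\<forall>\<^sub>F n in sequentially. residue_density n (not_sum_two_squares_mod n)
      = 1 - residue_density n (sum_two_squares_mod n)"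
    using eventually_gt_at_top[of 0] by eventually_elim (rule residue_density_not_sum_two_squares_mod)
  \<comment> \<open>Complementation exchanges densities near 0 and near 1, so the two frequency
    lemmas swap roles.\<close>
  have small: "\<exists>\<^sub>F n in sequentially. residue_density n (not_sum_two_squares_mod n) < e" if "e > 0" for e
    by (rule frequently_rev_mp[OF frequently_density_sum_two_squares_eq_1])
      (use compl that in \<open>eventually_elim, auto\<close>)
  have large: "\<exists>\<^sub>F n in sequentially. 1 - e < residue_density n (not_sum_two_squares_mod n)" if "e > 0" for e
    by (rule frequently_rev_mp[OF frequently_density_sum_two_squares_less[OF that]])
      (use compl in \<open>eventually_elim, auto\<close>)
  have "eventually (\<lambda>n. 0 \<le> residue_density n (not_sum_two_squares_mod n)) sequentially"
    "eventually (\<lambda>n. residue_density n (not_sum_two_squares_mod n) \<le> 1) sequentially"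
    using compl by (eventually_elim, use residue_density_bounds in simp)+
  moreover have "\<exists>\<^sub>F n in sequentially. 1 - e < residue_density n (sum_two_squares_mod n)" if "e > 0" for e
    using frequently_density_sum_two_squares_eq_1 that by (auto elim: frequently_elim1)
  ultimately show ?thesis
    using frequently_density_sum_two_squares_less small large residue_density_bounds
    by (intro conjI liminf_eq_0I limsup_eq_1I) auto
qed

end
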